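(* Let $X$ be a finite set and let $\mathcal{S}$ be an inverse submonoid of the symmetric inverse monoid $\operatorname{PSym}(X)$. There exists an edge-colored digraph $\Gamma=(X,E_1,\ldots,E_l)$ on the vertex set $X$ whose partial automorphism monoid $\operatorname{PAut}(\Gamma)$ is equal to $\mathcal{S}$ if and only if the following two conditions hold: (1) $\mathcal{S}$ is a full inverse submonoid of $\operatorname{PSym}(X)$; (2) for any compatible subset $A\subseteq\mathcal{S}$ of partial permutations of rank $1$, if $\mathcal{S}$ contains the join of any two elements of $A$, then $\mathcal{S}$ contains the join of the set $A$.
   Context: An edge-colored digraph is a structure $\Gamma=(V,E_1,\ldots,E_l)$ where $V$ is a finite set, $\{1,\ldots,l\}$ is the set of colors, and $E_1,\ldots,E_l\subseteq V\times V$ are pairwise disjoint sets of directed edges (loops allowed). A partial permutation of a finite set $X$ is a bijection $\varphi:Y\to Z$ between subsets $Y,Z\subseteq X$ (possibly empty); its rank is $|Y|=|Z|$. $\operatorname{PSym}(X)$ is the inverse monoid of all partial permutations of $X$ under composition of partial maps ($\psi\varphi$ means $\varphi$ first, then $\psi$, defined wherever this makes sense), with $\varphi^{-1}$ the inverse bijection. An inverse submonoid is a subset containing $\mathrm{id}_X$ and closed under composition and inverses; it is full if it contains all idempotents of $\operatorname{PSym}(X)$, i.e. all $\mathrm{id}_Y$, $Y\subseteq X$. A partial automorphism of $\Gamma$ is an isomorphism between two vertex-induced subgraphs, i.e. a bijection $\varphi:V_1\to V_2$ with $V_1,V_2\subseteq V$ such that for all $u,v\in V_1$ and every color $c$, $(u,v)\in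 E_c$ iff $(\varphi(u),\varphi(v))\in E_c$ (the empty map is allowed); $\operatorname{PAut}(\Gamma)$ is the inverse submonoid of $\operatorname{PSym}(V)$ of all partial automorphisms. Partial permutations $\varphi,\psi$ are compatible if $\varphi^{-1}\psi$ and $\varphi\psi^{-1}$ are idempotents, equivalently if the union of $\varphi$ and $\psi$ (as relations) is a partial permutation. A set is compatible if its elements are pairwise compatible. The join of a compatible set of partial permutations is the union of its elements, which is its least upper bound in $\operatorname{PSym}(X)$ with respect to the restriction order. *)

theory Defs
  imports "HOL-Library.Disjoint_Sets"
begin

text \<open>
  A partial permutation of \<open>X\<close> is represented by its graph, a relation on \<open>X\<close>.
  Relation composition \<open>\<phi> O \<psi>\<close> applies \<open>\<phi>\<close> first, so the product that is
  written \<open>\<psi>\<phi>\<close> for partial maps is \<open>\<phi> O \<psi>\<close> here.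
\<close>

definition PSym :: "'a set \<Rightarrow> ('a \<times> 'a) set set" where
  "PSym X = {\<phi>. \<phi> \<subseteq> X \<times> X \<and> single_valued \<phi> \<and> single_valued (\<phi>\<inverse>)}"

definition rank :: "('a \<times> 'a) set \<Rightarrow> nat" where
  "rank \<phi> = card (Domain \<phi>)"

definition idempotent :: "('a \<times> 'a) set \<Rightarrow> bool" where
  "idempotent \<phi> \<longleftrightarrow> \<phi> O \<phi> = \<phi>"

definition inverse_submonoid :: "'a set \<Rightarrow> ('a \<times> 'a) set set \<Rightarrow> bool" where
  "inverse_submonoid X S \<longleftrightarrow>
     S \<subseteq> PSym X \<and> Id_on X \<in> S \<and>
     (\<forall>\<phi>\<in>S. \<forall>\<psi>\<in>S. \<phi> O \<psi> \<in> S) \<and> (\<forall>\<phi>\<in>S. \<phi>\<inverse> \<in> S)"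

definition full_inverse_submonoid :: "'a set \<Rightarrow> ('a \<times> 'a) set set \<Rightarrow> bool" where
  "full_inverse_submonoid X S \<longleftrightarrow>
     inverse_submonoid X S \<and> (\<forall>\<epsilon>\<in>PSym X. idempotent \<epsilon> \<longrightarrow> \<epsilon> \<in> S)"

text \<open>
  In the notation of partial maps, the two products below are
  \<open>\<phi>\<inverse>\<psi>\<close> and \<open>\<phi>\<psi>\<inverse>\<close>.
\<close>

definition compatible :: "('a \<times> 'a) set \<Rightarrow> ('a \<times> 'a) set \<Rightarrow> bool" where
  "compatible \<phi> \<psi> \<longleftrightarrow> idempotent (\<psi> O \<phi>\<inverse>) \<and> idempotent (\<psi>\<inverse> O \<phi>)"

definition compatible_set :: "('a \<times> 'a) set set \<Rightarrow> bool" where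
  "compatible_set A \<longleftrightarrow> (\<forall>\<phi>\<in>A. \<forall>\<psi>\<in>A. compatible \<phi> \<psi>)"

definition join :: "('a \<times> 'a) set set \<Rightarrow> ('a \<times> 'a) set" where
  "join A = \<Union>A"

text \<open>
  The colors are \<open>1, \<dots>, num_colors \<Gamma>\<close>; the values of \<open>edges \<Gamma>\<close> at other
  numbers are irrelevant. Color classes may be empty.
\<close>

record 'a colored_digraph =
  verts :: "'a set"
  num_colors :: nat
  edges :: "nat \<Rightarrow> ('a \<times> 'a) set"

definition edge_colored_digraph :: "'a colored_digraph \<Rightarrow> bool" where
  "edge_colored_digraph \<Gamma> \<longleftrightarrow>
     finite (verts \<Gamma>) \<and>
     (\<forall>c\<in>{1..num_colors \<Gamma>}. edges \<Gamma> c \<subseteq> verts \<Gamma> \<times> verts \<Gamma>) \<and>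
     disjoint_family_on (edges \<Gamma>) {1..num_colors \<Gamma>}"

definition PAut :: "'a colored_digraph \<Rightarrow> ('a \<times> 'a) set set" where
  "PAut \<Gamma> = {\<phi> \<in> PSym (verts \<Gamma>).
     \<forall>(u, u')\<in>\<phi>. \<forall>(v, v')\<in>\<phi>. \<forall>c\<in>{1..num_colors \<Gamma>}.
       (u, v) \<in> edges \<Gamma> c \<longleftrightarrow> (u', v') \<in> edges \<Gamma> c}"

lemma idempotent_PSym_iff:
  assumes "\<epsilon> \<in> PSym X"
  shows "idempotent \<epsilon> \<longleftrightarrow> (\<exists>Y\<subseteq>X. \<epsilon> = Id_on Y)"
proof
  assume id: "idempotent \<epsilon>"
  have diag: "x = y" if xy: "(x, y) \<in> \<epsilon>" for x y
  proof -
    have "(x, y) \<in> \<epsilon> O \<epsilon>" using id xy unfolding idempotent_def by simp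
    then obtain z where z: "(x, z) \<in> \<epsilon>" "(z, y) \<in> \<epsilon>" by (rule relcompEpair)
    have sv: "single_valued \<epsilon>" "single_valued (\<epsilon>\<inverse>)" using assms unfolding PSym_def by auto
    have "z = y" by (rule single_valuedD[OF sv(1) z(1) xy])
    moreover have "x = z"
      using single_valuedD[OF sv(2), of y x z] xy z(2) by simp
    ultimately show ?thesis by simp
  qed
  have "\<epsilon> = Id_on (Domain \<epsilon>)"
    using diag by (auto simp: Id_on_def dest: diag)
  moreover have "Domain \<epsilon> \<subseteq> X" using assms unfolding PSym_def by blast
  ultimately show "\<exists>Y\<subseteq>X. \<epsilon> = Id_on Y" by blast
qed (auto simp: idempotent_def)

lemma compatible_iff_Un_PSym:
  assumes "\<phi> \<in> PSym X" "\<psi> \<in> PSym X"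
  shows "compatible \<phi> \<psi> \<longleftrightarrow> \<phi> \<union> \<psi> \<in> PSym X"
proof -
  have P: "\<psi> O \<phi>\<inverse> \<in> PSym X" "\<psi>\<inverse> O \<phi> \<in> PSym X"
    using assms by (auto simp: PSym_def intro!: single_valued_relcomp simp: converse_relcomp)
  have diag: "idempotent \<epsilon> \<longleftrightarrow> (\<forall>x y. (x, y) \<in> \<epsilon> \<longrightarrow> x = y)"
    if "\<epsilon> \<in> PSym X" for \<epsilon>
  proof
    assume "idempotent \<epsilon>"
    then show "\<forall>x y. (x, y) \<in> \<epsilon> \<longrightarrow> x = y"
      unfolding idempotent_PSym_iff[OF that] by auto
  next
    assume "\<forall>x y. (x, y) \<in> \<epsilon> \<longrightarrow> x = y"
    then show "idempotent \<epsilon>" by (auto simp: idempotent_def relcomp_unfold)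
  qed
  have "compatible \<phi> \<psi> \<longleftrightarrow>
      (\<forall>x y z. (x, y) \<in> \<psi> \<longrightarrow> (z, y) \<in> \<phi> \<longrightarrow> x = z) \<and>
      (\<forall>x y z. (x, y) \<in> \<psi> \<longrightarrow> (x, z) \<in> \<phi> \<longrightarrow> y = z)"
    unfolding compatible_def diag[OF P(1)] diag[OF P(2)] by (simp add: relcomp_unfold) blast
  also have "\<dots> \<longleftrightarrow> \<phi> \<union> \<psi> \<in> PSym X"
    using assms unfolding PSym_def single_valued_def mem_Collect_eq Un_iff converse_iff
    by simp (intro iffI conjI allI impI; elim conjE; metis)
  finally show ?thesis .
qed

end

theory Submission imports Defs begin

text \<open>
  A partial permutation is a partial automorphism iff each union of two of its
  rank-\<open>1\<close> restrictions is one, so \<open>PAut\<close> satisfies both conditions.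
  Conversely, the partial permutations of rank at most \<open>2\<close> in \<open>S\<close> define an
  equivalence relation on \<open>X \<times> X\<close>, relating \<open>(u, v)\<close> to \<open>(u', v')\<close> when
  \<open>{(u, u'), (v, v')} \<in> S\<close>. Its classes, taken as color classes, give the digraph:
  a partial automorphism \<open>\<phi>\<close> of it is the join of its restrictions to single points,
  whose pairwise joins lie in \<open>S\<close>, so that condition (2) yields \<open>\<phi> \<in> S\<close>.
\<close>

definition pair_rel :: "('a \<times> 'a) set set \<Rightarrow> (('a \<times> 'a) \<times> ('a \<times> 'a)) set" where
  "pair_rel S = {((u, v), (u', v')). {(u, u'), (v, v')} \<in> S}"

lemma Id_on_PSym: "Y \<subseteq> X \<Longrightarrow> Id_on Y \<in> PSym X"
  by (auto simp: PSym_def single_valued_def)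

lemma full_imp_Id_on: "full_inverse_submonoid X S \<Longrightarrow> Y \<subseteq> X \<Longrightarrow> Id_on Y \<in> S"
  using Id_on_PSym idempotent_PSym_iff unfolding full_inverse_submonoid_def by blast

text \<open>Precomposing with the partial identity on \<open>Domain \<psi>\<close> cuts
  \<open>\<phi>\<close> down to \<open>\<psi>\<close>. Fullness supplies this idempotent, so
  \<open>S\<close> is downward closed in the restriction order.\<close>

lemma full_imp_restrict:
  assumes "full_inverse_submonoid X S" and "\<phi> \<in> S" and "\<psi> \<subseteq> \<phi>"
  shows "\<psi> \<in> S"
proof -
  have sub: "S \<subseteq> PSym X" and comp: "\<And>\<alpha> \<beta>. \<alpha> \<in> S \<Longrightarrow> \<beta> \<in> S \<Longrightarrow> \<alpha> O \<beta> \<in> S"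
    using assms(1) unfolding full_inverse_submonoid_def inverse_submonoid_def by auto
  have \<phi>: "\<phi> \<subseteq> X \<times> X" "single_valued \<phi>"
    using sub assms(2) by (auto simp: PSym_def)
  have "Id_on (Domain \<psi>) \<in> S"
    using assms(1,3) \<phi>(1) by (intro full_imp_Id_on) auto
  moreover have "Id_on (Domain \<psi>) O \<phi> = \<psi>"
    using \<phi>(2) assms(3) by (auto dest: single_valuedD)
  ultimately show ?thesis
    using comp assms(2) by metis
qed

text \<open>Idempotents give reflexivity, inverses symmetry and products transitivity. The classes
  are the orbits of \<open>S\<close> acting partially on ordered pairs.\<close>

lemma equiv_pair_rel:
  assumes full: "full_inverse_submonoid X S"
  shows "equiv (X \<times> X) (pair_rel S)"
proof (rule equivI)
  have S: "S \<subseteq> PSym X" "\<And>\<alpha> \<beta>. \<alpha> \<in> S \<Longrightarrow> \<beta> \<in> S \<Longrightarrow> \<alpha> O \<beta> \<in> S" "\<And>\<alpha>. \<alpha> \<in> S \<Longrightarrow> \<alpha>\<inverse> \<in> S"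
    using full unfolding full_inverse_submonoid_def inverse_submonoid_def by auto
  show "pair_rel S \<subseteq> (X \<times> X) \<times> (X \<times> X)"
    using S(1) by (fastforce simp: pair_rel_def PSym_def)
  show "refl_on (X \<times> X) (pair_rel S)"
  proof (rule refl_onI)
    fix p assume "p \<in> X \<times> X"
    then have "Id_on {fst p, snd p} \<in> S"
      by (intro full_imp_Id_on[OF full]) auto
    moreover have "Id_on {fst p, snd p} = {(fst p, fst p), (snd p, snd p)}"
      by auto
    ultimately show "(p, p) \<in> pair_rel S"
      by (auto simp: pair_rel_def case_prod_beta)
  qed
  show "sym (pair_rel S)"
  proof (rule symI, clarify)
    fix u v u' v' assume "((u, v), (u', v')) \<in> pair_rel S"
    then have "{(u, u'), (v, v')}\<inverse> \<in> S"
      using S(3) by (simp add: pair_rel_def)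
    moreover have "{(u, u'), (v, v')}\<inverse> = {(u', u), (v', v)}"
      by auto
    ultimately show "((u', v'), (u, v)) \<in> pair_rel S"
      by (simp add: pair_rel_def)
  qed
  show "trans (pair_rel S)"
  proof (rule transI, clarify)
    fix u v u' v' u'' v''
    assume *: "((u, v), (u', v')) \<in> pair_rel S" "((u', v'), (u'', v'')) \<in> pair_rel S"
    then have "{(u, u'), (v, v')} O {(u', u''), (v', v'')} \<in> S"
      using S(2) by (simp add: pair_rel_def)
    \<comment> \<open>The inclusion suffices by closure under restriction, and it spares a case
      split on whether \<open>u' = v'\<close>.\<close>
    moreover have "{(u, u''), (v, v'')} \<subseteq> {(u, u'), (v, v')} O {(u', u''), (v', v'')}"
      by auto
    ultimately show "((u, v), (u'', v'')) \<in> pair_rel S"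
      by (simp add: pair_rel_def full_imp_restrict[OF full])
  qed
qed

text \<open>Partial identities preserve every color. The inverse submonoid property is assumed
  because the theorem grants it to \<open>S\<close>, which is \<open>PAut \<Gamma>\<close> where
  this is applied.\<close>

lemma full_inverse_submonoid_PAut:
  assumes "inverse_submonoid (verts \<Gamma>) (PAut \<Gamma>)"
  shows "full_inverse_submonoid (verts \<Gamma>) (PAut \<Gamma>)"
  unfolding full_inverse_submonoid_def
proof (intro conjI ballI impI assms)
  fix \<epsilon> assume "\<epsilon> \<in> PSym (verts \<Gamma>)" "idempotent \<epsilon>"
  then obtain Y where "Y \<subseteq> verts \<Gamma>" "\<epsilon> = Id_on Y"
    using idempotent_PSym_iff by blast
  then show "\<epsilon> \<in> PAut \<Gamma>"
    using Id_on_PSym[of Y "verts \<Gamma>"] by (auto simp: PAut_def)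
qed

text \<open>Single-valuedness, injectivity and color preservation each constrain only two pairs of
  the relation at a time, and any two pairs of \<open>\<Union>A\<close> lie in a common
  \<open>\<phi> \<union> \<psi>\<close>.\<close>

lemma Union_in_PAut:
  assumes "\<And>\<phi> \<psi>. \<phi> \<in> A \<Longrightarrow> \<psi> \<in> A \<Longrightarrow> \<phi> \<union> \<psi> \<in> PAut \<Gamma>"
  shows "\<Union>A \<in> PAut \<Gamma>"
proof -
  have pair: "\<exists>\<chi>\<in>PAut \<Gamma>. p \<in> \<chi> \<and> q \<in> \<chi>" if "p \<in> \<Union>A" "q \<in> \<Union>A" for p q
    using that assms by blast
  have "\<Union>A \<subseteq> verts \<Gamma> \<times> verts \<Gamma>"
    using pair unfolding PAut_def PSym_def by blast
  moreover have "single_valued (\<Union>A)"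
  proof (rule single_valuedI)
    fix x y z assume "(x, y) \<in> \<Union>A" "(x, z) \<in> \<Union>A"
    then obtain \<chi> where "\<chi> \<in> PAut \<Gamma>" "(x, y) \<in> \<chi>" "(x, z) \<in> \<chi>"
      using pair by meson
    then show "y = z" by (auto simp: PAut_def PSym_def dest: single_valuedD)
  qed
  moreover have "single_valued ((\<Union>A)\<inverse>)"
  proof (rule single_valuedI)
    fix x y z assume "(x, y) \<in> (\<Union>A)\<inverse>" "(x, z) \<in> (\<Union>A)\<inverse>"
    then obtain \<chi> where "\<chi> \<in> PAut \<Gamma>" "(y, x) \<in> \<chi>" "(z, x) \<in> \<chi>"
      using pair unfolding converse_iff by meson
    then show "y = z" by (auto simp: PAut_def PSym_def single_valued_def)
  qed
  moreover have "(u, v) \<in> edges \<Gamma> c \<longleftrightarrow> (u', v') \<in> edges \<Gamma> c"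
    if uv: "(u, u') \<in> \<Union>A" "(v, v') \<in> \<Union>A" and c: "c \<in> {1..num_colors \<Gamma>}" for u u' v v' c
  proof -
    obtain \<chi> where "\<chi> \<in> PAut \<Gamma>" "(u, u') \<in> \<chi>" "(v, v') \<in> \<chi>"
      using pair[OF uv] by blast
    then show ?thesis using c unfolding PAut_def by blast
  qed
  ultimately show ?thesis
    unfolding PAut_def PSym_def by blast
qed

text \<open>Each class of \<open>R\<close> becomes one color. Since the classes partition
  \<open>X \<times> X\<close>, preserving all colors means moving each pair within its
  class.\<close>

lemma ex_digraph_of_equiv:
  assumes "finite X" and equiv: "equiv (X \<times> X) R"
  obtains \<Gamma> :: "'a colored_digraph"
    where "edge_colored_digraph \<Gamma>" and "verts \<Gamma> = X"
      and "PAut \<Gamma> = {\<phi> \<in> PSym X. \<forall>(u, u')\<in>\<phi>. \<forall>(v, v')\<in>\<phi>. ((u, v), (u', v')) \<in> R}"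
proof -
  let ?Q = "(X \<times> X) // R"
  have "finite ?Q"
    using assms by (auto intro: finite_quotient simp: equiv_def)
  \<comment> \<open>The enumeration starts at 1 to match the color set; its injectivity will make
    distinct colors disjoint.\<close>
  then obtain h l where h: "bij_betw h {1..l::nat} ?Q"
    using ex_bij_betw_nat_finite_1 by blast
  define \<Gamma> where "\<Gamma> = \<lparr>verts = X, num_colors = l, edges = h\<rparr>"
  have disj: "disjoint_family_on h {1..l}"
    unfolding disjoint_family_on_def
  proof (intro ballI impI)
    fix m n assume mn: "m \<in> {1..l}" "n \<in> {1..l}" "m \<noteq> n"
    then have "h m \<noteq> h n"
      using h by (auto simp: bij_betw_def dest: inj_onD)
    moreover have "h m \<in> ?Q" "h n \<in> ?Q"
      using h mn by (auto simp: bij_betw_def)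
    ultimately show "h m \<inter> h n = {}"
      using quotient_disj[OF equiv] by blast
  qed
  have "h c \<subseteq> X \<times> X" if "c \<in> {1..l}" for c
  proof -
    have "h c \<in> ?Q"
      using h that by (rule bij_betw_apply)
    then have "h c \<subseteq> \<Union>?Q"
      by blast
    then show ?thesis
      by (simp only: Union_quotient[OF equiv])
  qed
  with disj have ecd: "edge_colored_digraph \<Gamma>"
    using assms(1) by (auto simp: edge_colored_digraph_def \<Gamma>_def)
  have verts: "verts \<Gamma> = X"
    by (simp add: \<Gamma>_def)
  have in_same_classes_iff: "(\<forall>c\<in>{1..l}. p \<in> h c \<longleftrightarrow> q \<in> h c) \<longleftrightarrow> (p, q) \<in> R"
    if pq: "p \<in> X \<times> X" "q \<in> X \<times> X" for p q
  proof -
    \<comment> \<open>Surjectivity of \<open>h\<close> turns quantification over colors into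
      quantification over classes.\<close>
    have "(\<forall>c\<in>{1..l}. p \<in> h c \<longleftrightarrow> q \<in> h c) \<longleftrightarrow> (\<forall>C\<in>?Q. p \<in> C \<longleftrightarrow> q \<in> C)"
      by (simp only: bij_betw_imp_surj_on[OF h, symmetric] ball_simps)
    also have "\<dots> \<longleftrightarrow> (p, q) \<in> R"
    proof
      assume "\<forall>C\<in>?Q. p \<in> C \<longleftrightarrow> q \<in> C"
      \<comment> \<open>The class of \<open>p\<close> itself is the one to test.\<close>
      then have "q \<in> R `` {p}"
        using equiv_class_self[OF equiv pq(1)] quotientI[OF pq(1)] by blast
      then show "(p, q) \<in> R" by simp
    next
      assume pqR: "(p, q) \<in> R"
      then have "(q, p) \<in> R"
        using equiv by (meson equivE symD)
      with pqR show "\<forall>C\<in>?Q. p \<in> C \<longleftrightarrow> q \<in> C"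
        using in_quotient_imp_closed[OF equiv] by blast
    qed
    finally show ?thesis .
  qed
  have same_color_iff: "(\<forall>c\<in>{1..num_colors \<Gamma>}. (u, v) \<in> edges \<Gamma> c \<longleftrightarrow> (u', v') \<in> edges \<Gamma> c) \<longleftrightarrow>
        ((u, v), (u', v')) \<in> R"
    if "\<phi> \<in> PSym X" "(u, u') \<in> \<phi>" "(v, v') \<in> \<phi>" for \<phi> u u' v v'
  proof -
    have "(u, v) \<in> X \<times> X" "(u', v') \<in> X \<times> X"
      using that by (auto simp: PSym_def)
    from in_same_classes_iff[OF this] show ?thesis
      by (simp add: \<Gamma>_def)
  qed
  have "PAut \<Gamma> = {\<phi> \<in> PSym X. \<forall>(u, u')\<in>\<phi>. \<forall>(v, v')\<in>\<phi>. ((u, v), (u', v')) \<in> R}"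
    unfolding PAut_def verts split_beta
    \<comment> \<open>The congruence rules keep \<open>\<phi> \<in> PSym X\<close> and the two
      memberships in \<open>\<phi>\<close> at hand, as \<open>same_color_iff\<close>
      requires.\<close>
    by (intro Collect_cong conj_cong refl ball_cong same_color_iff) simp_all
  with ecd verts show thesis
    using that by blast
qed

theorem theorem5p3:
  fixes X :: "'a set" and S :: "('a \<times> 'a) set set"
  assumes "finite X" and "inverse_submonoid X S"
  shows "(\<exists>\<Gamma> :: 'a colored_digraph.
            edge_colored_digraph \<Gamma> \<and> verts \<Gamma> = X \<and> PAut \<Gamma> = S) \<longleftrightarrow>
         full_inverse_submonoid X S \<and>
         (\<forall>A\<subseteq>S. (\<forall>\<phi>\<in>A. rank \<phi> = 1) \<longrightarrow> compatible_set A \<longrightarrow>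
            (\<forall>\<phi>\<in>A. \<forall>\<psi>\<in>A. join {\<phi>, \<psi>} \<in> S) \<longrightarrow> join A \<in> S)"
    (is "?graph \<longleftrightarrow> _ \<and> ?joins")
proof (intro iffI conjI)
  assume ?graph
  then obtain \<Gamma> :: "'a colored_digraph" where \<Gamma>: "verts \<Gamma> = X" "PAut \<Gamma> = S"
    by blast
  show "full_inverse_submonoid X S"
    using full_inverse_submonoid_PAut[of \<Gamma>] assms(2) by (simp add: \<Gamma>)
  show ?joins
    using Union_in_PAut[of _ \<Gamma>] by (simp add: \<Gamma> join_def)
next
  assume "full_inverse_submonoid X S \<and> ?joins"
  then have full: "full_inverse_submonoid X S" and joins: ?joins
    by blast+
  have sub: "S \<subseteq> PSym X"
    using assms(2) by (simp add: inverse_submonoid_def)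
  \<comment> \<open>By \<open>ex_digraph_of_equiv\<close>, the left-hand side is \<open>PAut\<close>
    of a digraph whose colors are the classes of \<open>pair_rel S\<close>.\<close>
  have "{\<phi> \<in> PSym X. \<forall>(u, u')\<in>\<phi>. \<forall>(v, v')\<in>\<phi>. ((u, v), (u', v')) \<in> pair_rel S} = S"
    (is "?P = S")
  proof (intro equalityI subsetI)
    fix \<phi> assume "\<phi> \<in> S"
    then have "{p, q} \<in> S" if "p \<in> \<phi>" "q \<in> \<phi>" for p q
      using that full_imp_restrict[OF full] by simp
    with sub \<open>\<phi> \<in> S\<close> show "\<phi> \<in> ?P"
      by (auto simp: pair_rel_def)
  next
    fix \<phi> assume "\<phi> \<in> ?P"
    then have pair: "{p, q} \<in> S" if "p \<in> \<phi>" "q \<in> \<phi>" for p q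
      using that by (auto simp: pair_rel_def)
    \<comment> \<open>Joins of two members of \<open>A\<close> are the sets \<open>{p, q}\<close>
      that \<open>pair\<close> places in \<open>S\<close>; the case \<open>p = q\<close> gives
      \<open>A \<subseteq> S\<close>.\<close>
    define A where "A = (\<lambda>p. {p}) ` \<phi>"
    have "A \<subseteq> S"
      using pair by (force simp: A_def)
    moreover have "\<forall>\<alpha>\<in>A. rank \<alpha> = 1"
      by (auto simp: A_def rank_def)
    moreover have in_S: "\<forall>\<alpha>\<in>A. \<forall>\<beta>\<in>A. \<alpha> \<union> \<beta> \<in> S"
      using pair by (auto simp: A_def insert_commute)
    \<comment> \<open>Unions of two members lie in \<open>S\<close>, hence are partial permutations,
      which is compatibility.\<close>
    moreover have "compatible_set A"
      unfolding compatible_set_def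
      using \<open>A \<subseteq> S\<close> in_S sub compatible_iff_Un_PSym[of _ X] by blast
    ultimately have "join A \<in> S"
      using joins by (simp add: join_def)
    moreover have "join A = \<phi>"
      by (auto simp: join_def A_def)
    ultimately show "\<phi> \<in> S"
      by simp
  qed
  then show ?graph
    using ex_digraph_of_equiv[OF assms(1) equiv_pair_rel[OF full]] by metis
qed

end
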